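(* Let $\mathcal{G}$ be a locally compact group and let $\mathcal{X}$ be a $\mathcal{G}$-space. Then $\mathfrak{Z}(\mathcal{X},\mathcal{G})$ is precisely the set of all $m\in LUC(\mathcal{G})^*$ for which the following conditions are satisfied: (a) $Fm\in LUC(\mathcal{X},\mathcal{G})$ for all $F\in LUC(\mathcal{X},\mathcal{G})$; (b) $M\bullet m=m\cdot M$ for all $M\in LUC(\mathcal{X},\mathcal{G})^*$.
   Context: A (left) $\mathcal{G}$-space is a locally compact Hausdorff space $\mathcal{X}$ with a continuous map $\mathcal{G}\times\mathcal{X}\to\mathcal{X}$, $(s,x)\mapsto s\cdot x$, such that $(st)\cdot x=s\cdot(t\cdot x)$ and $e\cdot x=x$ for all $s,t\in\mathcal{G}$, $x\in\mathcal{X}$, where $e$ is the identity of $\mathcal{G}$. $C_b(\mathcal{X})$ is the space of bounded continuous complex-valued functions on $\mathcal{X}$ with the supremum norm. For $F\in C_b(\mathcal{X})$ and $s\in\mathcal{G}$ put $(l_sF)(x)=F(s\cdot x)$, and let $$LUC(\mathcal{X},\mathcal{G})=\{F\in C_b(\mathcal{X}): s\mapsto l_sF \text{ is continuous from } \mathcal{G} \text{ into } (C_b(\mathcal{X}),\|\cdot\|_\infty)\},$$ a closed subspace of $C_b(\mathcal{X})$ invariant under all $l_s$. $LUC(\mathcal{G})=LUC(\mathcal{G},\mathcal{G})$, with $\mathcal{G}$ acting on itself by left translation. For $M\in LUC(\mathcal{X},\mathcal{G})^*$ and $F\in LUC(\mathcal{X},\mathcal{G})$, the function $MF\in LUC(\mathcal{G})$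 is given by $(MF)(s)=\langle M,l_sF\rangle$. For $m\in LUC(\mathcal{G})^*$, the functional $m\cdot M\in LUC(\mathcal{X},\mathcal{G})^*$ is given by $\langle m\cdot M,F\rangle=\langle m,MF\rangle$. Define $$\mathfrak{Z}(\mathcal{X},\mathcal{G})=\{m\in LUC(\mathcal{G})^*: M\mapsto m\cdot M \text{ is weak}^*\text{ to weak}^*\text{ continuous on } LUC(\mathcal{X},\mathcal{G})^*\}.$$ For $F\in LUC(\mathcal{X},\mathcal{G})$ and $x\in\mathcal{X}$, the function $r_xF\in LUC(\mathcal{G})$ is $(r_xF)(s)=F(s\cdot x)$; for $m\in LUC(\mathcal{G})^*$, the bounded function $Fm:\mathcal{X}\to\mathbb{C}$ is $(Fm)(x)=\langle m,r_xF\rangle$. If $Fm\in LUC(\mathcal{X},\mathcal{G})$ for every $F\in LUC(\mathcal{X},\mathcal{G})$, then for $M\in LUC(\mathcal{X},\mathcal{G})^*$ the linear functional $M\bullet m$ on $LUC(\mathcal{X},\mathcal{G})$ is defined by $\langle M\bullet m,F\rangle=\langle M,Fm\rangle$ (so condition (b) is meaningful once (a) holds). *)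

theory Defs
  imports "HOL-Analysis.Analysis"
begin

text \<open>
  Groups are written additively, following the library class \<open>topological_group_add\<close>; this class
  is not commutative, so \<open>s + t\<close> is the product \<open>st\<close> and \<open>0\<close> is the identity \<open>e\<close>.
  The space of bounded continuous functions \<open>C\<^sub>b(X)\<close> is the library type \<open>'x \<Rightarrow>\<^sub>C complex\<close>,
  normed by the supremum norm.
\<close>

locale G_space =
  fixes act :: "'g::{topological_group_add,t2_space} \<Rightarrow> 'x::t2_space \<Rightarrow> 'x"
  assumes locally_compact: "locally_compact_space (euclidean :: 'x topology)"
    and continuous_act: "continuous_on UNIV (\<lambda>(s, x). act s x)"
    and act_add: "act (s + t) x = act s (act t x)"
    and act_zero: "act 0 x = x"

text \<open>
  \<open>Bcontfun\<close> returns a meaningful value only on functions that are bounded and continuous.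
  The lemmas \<open>apply_cscale\<close>, \<open>G_space.apply_ltrans\<close>, \<open>G_space.apply_rtrans\<close> and
  \<open>apply_dual_conv\<close> below show that this is the case for \<open>c F\<close>, \<open>l\<^sub>s F\<close>, \<open>r\<^sub>x F\<close> and \<open>M F\<close>.
\<close>

definition cscale :: "complex \<Rightarrow> ('x::topological_space \<Rightarrow>\<^sub>C complex) \<Rightarrow> ('x \<Rightarrow>\<^sub>C complex)"
  where "cscale c F = Bcontfun (\<lambda>x. c * F x)"

definition ltrans :: "('g \<Rightarrow> 'x \<Rightarrow> 'x) \<Rightarrow> 'g \<Rightarrow> ('x::topological_space \<Rightarrow>\<^sub>C complex) \<Rightarrow> ('x \<Rightarrow>\<^sub>C complex)"
  where "ltrans act s F = Bcontfun (\<lambda>x. F (act s x))"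

definition rtrans ::
    "('g::topological_space \<Rightarrow> 'x \<Rightarrow> 'x) \<Rightarrow> 'x \<Rightarrow> ('x::topological_space \<Rightarrow>\<^sub>C complex) \<Rightarrow> ('g \<Rightarrow>\<^sub>C complex)"
  where "rtrans act x F = Bcontfun (\<lambda>s. F (act s x))"

text \<open>\<open>LUC (+)\<close> is \<open>LUC(G)\<close>, for \<open>G\<close> acting on itself by left translation.\<close>

definition LUC :: "('g::topological_space \<Rightarrow> 'x \<Rightarrow> 'x) \<Rightarrow> ('x::topological_space \<Rightarrow>\<^sub>C complex) set"
  where "LUC act = {F. continuous_on UNIV (\<lambda>s. ltrans act s F)}"

text \<open>
  The dual of a linear subspace \<open>V\<close> of \<open>C\<^sub>b(X)\<close>: bounded complex-linear functionals on \<open>V\<close>.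
  They are represented by functions that are \<open>undefined\<close> outside \<open>V\<close>, so that equality of
  functionals is equality on \<open>V\<close> and the weak* topology is induced by the product
  topology over the index set \<open>V\<close>.
\<close>

definition cdual ::
    "('x::topological_space \<Rightarrow>\<^sub>C complex) set \<Rightarrow> (('x \<Rightarrow>\<^sub>C complex) \<Rightarrow> complex) set"
  where "cdual V = {M \<in> extensional V.
    (\<forall>F\<in>V. \<forall>H\<in>V. M (F + H) = M F + M H) \<and>
    (\<forall>c. \<forall>F\<in>V. M (cscale c F) = c * M F) \<and>
    (\<exists>B. \<forall>F\<in>V. norm (M F) \<le> B * norm F)}"

definition weak_star ::
    "('x::topological_space \<Rightarrow>\<^sub>C complex) set \<Rightarrow> (('x \<Rightarrow>\<^sub>C complex) \<Rightarrow> complex) topology"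
  where "weak_star V = subtopology (product_topology (\<lambda>_. euclidean) V) (cdual V)"

definition dual_conv ::
    "('g::topological_space \<Rightarrow> 'x \<Rightarrow> 'x) \<Rightarrow> (('x::topological_space \<Rightarrow>\<^sub>C complex) \<Rightarrow> complex) \<Rightarrow>
      ('x \<Rightarrow>\<^sub>C complex) \<Rightarrow> ('g \<Rightarrow>\<^sub>C complex)"
  where "dual_conv act M F = Bcontfun (\<lambda>s. M (ltrans act s F))"

definition dual_act ::
    "('g::topological_space \<Rightarrow> 'x \<Rightarrow> 'x) \<Rightarrow> (('g \<Rightarrow>\<^sub>C complex) \<Rightarrow> complex) \<Rightarrow>
      (('x::topological_space \<Rightarrow>\<^sub>C complex) \<Rightarrow> complex) \<Rightarrow> (('x \<Rightarrow>\<^sub>C complex) \<Rightarrow> complex)"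
  where "dual_act act m M = (\<lambda>F\<in>LUC act. m (dual_conv act M F))"

definition ZZ ::
    "('g::topological_group_add \<Rightarrow> 'x \<Rightarrow> 'x::topological_space) \<Rightarrow> (('g \<Rightarrow>\<^sub>C complex) \<Rightarrow> complex) set"
  where "ZZ act = {m \<in> cdual (LUC (+)).
    continuous_map (weak_star (LUC act)) (weak_star (LUC act)) (dual_act act m)}"

text \<open>The function \<open>Fm\<close>, which is bounded but need not be continuous.\<close>

definition fun_conv ::
    "('g::topological_space \<Rightarrow> 'x \<Rightarrow> 'x) \<Rightarrow> ('x::topological_space \<Rightarrow>\<^sub>C complex) \<Rightarrow>
      (('g \<Rightarrow>\<^sub>C complex) \<Rightarrow> complex) \<Rightarrow> 'x \<Rightarrow> complex"
  where "fun_conv act F m = (\<lambda>x. m (rtrans act x F))"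

text \<open>The functional \<open>M \<bullet> m\<close>; meaningful only if every \<open>Fm\<close> lies in \<open>LUC act\<close>.\<close>

definition dual_bullet ::
    "('g::topological_space \<Rightarrow> 'x \<Rightarrow> 'x) \<Rightarrow> (('x::topological_space \<Rightarrow>\<^sub>C complex) \<Rightarrow> complex) \<Rightarrow>
      (('g \<Rightarrow>\<^sub>C complex) \<Rightarrow> complex) \<Rightarrow> (('x \<Rightarrow>\<^sub>C complex) \<Rightarrow> complex)"
  where "dual_bullet act M m = (\<lambda>F\<in>LUC act. M (Bcontfun (fun_conv act F m)))"

lemma G_space_left_translation:
  assumes "locally_compact_space (euclidean :: 'g::{topological_group_add,t2_space} topology)"
  shows "G_space ((+) :: 'g \<Rightarrow> 'g \<Rightarrow> 'g)"
  by standard (auto simp: assms add.assoc case_prod_beta intro!: continuous_intros)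

lemma apply_cscale: "apply_bcontfun (cscale c F) x = c * apply_bcontfun F x"
proof -
  have "(\<lambda>x. c * apply_bcontfun F x) \<in> bcontfun"
    by (rule bcontfun_normI[of _ "norm c * norm F"])
      (auto simp: norm_mult intro!: continuous_intros mult_left_mono norm_bounded)
  then show ?thesis
    by (simp add: cscale_def Bcontfun_inverse)
qed

lemma bcontfun_compose:
  assumes "continuous_on UNIV f"
  shows "(\<lambda>x. apply_bcontfun F (f x)) \<in> bcontfun"
proof -
  have "continuous_on UNIV (\<lambda>x. apply_bcontfun F (f x))"
    by (rule continuous_on_compose2[OF continuous_on_apply_bcontfun assms]) auto
  moreover have "bounded (range (\<lambda>x. apply_bcontfun F (f x)))"
    by (rule bounded_subset[OF bounded_apply_bcontfun[of F]]) auto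
  ultimately show ?thesis
    by (simp add: bcontfun_def)
qed

context G_space
begin

lemma continuous_act_left: "continuous_on UNIV (act s)"
proof -
  have "continuous_on UNIV (\<lambda>x. (s, x))"
    by (intro continuous_intros)
  from continuous_on_compose2[OF continuous_act this] show ?thesis by simp
qed

lemma continuous_act_right: "continuous_on UNIV (\<lambda>s. act s x)"
proof -
  have "continuous_on UNIV (\<lambda>s::'g. (s, x))"
    by (intro continuous_intros)
  from continuous_on_compose2[OF continuous_act this] show ?thesis by simp
qed

lemma apply_ltrans: "apply_bcontfun (ltrans act s F) x = apply_bcontfun F (act s x)"
  by (simp add: ltrans_def Bcontfun_inverse bcontfun_compose continuous_act_left)

lemma apply_rtrans: "apply_bcontfun (rtrans act x F) s = apply_bcontfun F (act s x)"
  by (simp add: rtrans_def Bcontfun_inverse bcontfun_compose continuous_act_right)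

lemma ltrans_ltrans: "ltrans act s (ltrans act t F) = ltrans act (t + s) F"
  by (rule bcontfun_eqI) (simp add: apply_ltrans act_add)

lemma norm_ltrans_le: "norm (ltrans act s F) \<le> norm F"
  by (rule norm_bound) (simp add: apply_ltrans norm_bounded)

lemma ltrans_diff: "ltrans act s (F - H) = ltrans act s F - ltrans act s H"
  by (rule bcontfun_eqI) (simp add: apply_ltrans)

lemma ltrans_in_LUC:
  assumes "F \<in> LUC act"
  shows "ltrans act s F \<in> LUC act"
proof -
  have "continuous_on UNIV (\<lambda>t. ltrans act t F)"
    using assms by (simp add: LUC_def)
  moreover have "continuous_on UNIV (\<lambda>t. s + t)"
    by (intro continuous_intros)
  ultimately have "continuous_on UNIV (\<lambda>t. ltrans act (s + t) F)"
    by (rule continuous_on_compose2) simp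
  then show ?thesis
    by (simp add: LUC_def ltrans_ltrans)
qed

lemma LUC_diff:
  assumes "F \<in> LUC act" "H \<in> LUC act"
  shows "F - H \<in> LUC act"
  using assms by (auto simp: LUC_def ltrans_diff intro!: continuous_intros)

end

lemma cdual_diff:
  assumes M: "M \<in> cdual (LUC act)" and "G_space act" and FH: "F \<in> LUC act" "H \<in> LUC act"
  shows "M (F - H) = M F - M H"
proof -
  interpret G_space act by fact
  have "M F = M ((F - H) + H)" by simp
  also have "\<dots> = M (F - H) + M H"
    using M FH LUC_diff[OF FH] unfolding cdual_def by blast
  finally show ?thesis by simp
qed

lemma apply_dual_conv:
  assumes M: "M \<in> cdual (LUC act)" and G: "G_space act" and F: "F \<in> LUC act"
  shows "apply_bcontfun (dual_conv act M F) s = M (ltrans act s F)"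
proof -
  interpret G_space act by fact
  obtain B where B: "\<And>F. F \<in> LUC act \<Longrightarrow> norm (M F) \<le> B * norm F"
    using M unfolding cdual_def by blast
  have B': "norm (M F) \<le> \<bar>B\<bar> * norm F" if "F \<in> LUC act" for F
    by (rule order_trans[OF B[OF that]]) (simp add: mult_right_mono)
  have "continuous_on UNIV (\<lambda>s. M (ltrans act s F))"
    unfolding continuous_on
  proof
    fix s
    have "((\<lambda>t. ltrans act t F) \<longlongrightarrow> ltrans act s F) (at s)"
      using F by (simp add: LUC_def continuous_on)
    then have "((\<lambda>t. norm (ltrans act t F - ltrans act s F)) \<longlongrightarrow> 0) (at s)"
      by (simp add: tendsto_norm_zero LIM_zero)
    then have lim: "((\<lambda>t. \<bar>B\<bar> * norm (ltrans act t F - ltrans act s F)) \<longlongrightarrow> 0) (at s)"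
      by (rule tendsto_mult_right_zero)
    have "((\<lambda>t. M (ltrans act t F) - M (ltrans act s F)) \<longlongrightarrow> 0) (at s)"
    proof (rule Lim_null_comparison[OF _ lim], rule always_eventually, rule allI)
      fix t
      have "M (ltrans act t F) - M (ltrans act s F) = M (ltrans act t F - ltrans act s F)"
        using cdual_diff[OF M G ltrans_in_LUC[OF F] ltrans_in_LUC[OF F]] by simp
      then show "norm (M (ltrans act t F) - M (ltrans act s F)) \<le>
          \<bar>B\<bar> * norm (ltrans act t F - ltrans act s F)"
        using B'[OF LUC_diff[OF ltrans_in_LUC[OF F] ltrans_in_LUC[OF F]]] by simp
    qed
    then show "((\<lambda>t. M (ltrans act t F)) \<longlongrightarrow> M (ltrans act s F)) (at s within UNIV)"
      by (simp add: LIM_zero_iff)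
  qed
  moreover have "norm (M (ltrans act s F)) \<le> \<bar>B\<bar> * norm F" for s
    by (rule order_trans[OF B'[OF ltrans_in_LUC[OF F]]]) (simp add: mult_left_mono norm_ltrans_le)
  ultimately have "(\<lambda>s. M (ltrans act s F)) \<in> bcontfun"
    by (rule bcontfun_normI)
  then show ?thesis
    by (simp add: dual_conv_def Bcontfun_inverse)
qed

context G_space
begin

lemma rtrans_in_LUC:
  assumes lc: "locally_compact_space (euclidean :: 'g topology)" and F: "F \<in> LUC act"
  shows "rtrans act x F \<in> LUC (+)"
proof -
  interpret L: G_space "(+) :: 'g \<Rightarrow> 'g \<Rightarrow> 'g"
    by (rule G_space_left_translation[OF lc])
  have le: "dist (ltrans (+) s (rtrans act x F)) (ltrans (+) t (rtrans act x F)) \<le>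
      dist (ltrans act s F) (ltrans act t F)" for s t
  proof (rule dist_bound)
    fix u
    show "dist (ltrans (+) s (rtrans act x F) u) (ltrans (+) t (rtrans act x F) u) \<le>
        dist (ltrans act s F) (ltrans act t F)"
      using dist_bounded[of "ltrans act s F" "act u x" "ltrans act t F"]
      by (simp add: apply_ltrans L.apply_ltrans apply_rtrans act_add)
  qed
  show ?thesis
    unfolding LUC_def mem_Collect_eq continuous_on
  proof
    fix t
    have "((\<lambda>s. ltrans act s F) \<longlongrightarrow> ltrans act t F) (at t)"
      using F by (simp add: LUC_def continuous_on)
    then have lim: "((\<lambda>s. dist (ltrans act s F) (ltrans act t F)) \<longlongrightarrow> 0) (at t)"
      by (rule iffD1[OF tendsto_dist_iff])
    show "((\<lambda>s. ltrans (+) s (rtrans act x F)) \<longlongrightarrow> ltrans (+) t (rtrans act x F)) (at t within UNIV)"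
      by (rule iffD2[OF tendsto_dist_iff], rule Lim_null_comparison[OF _ lim], rule always_eventually) (simp add: le)
  qed
qed

lemma dual_conv_in_LUC:
  assumes lc: "locally_compact_space (euclidean :: 'g topology)"
    and M: "M \<in> cdual (LUC act)" and F: "F \<in> LUC act"
  shows "dual_conv act M F \<in> LUC (+)"
proof -
  interpret L: G_space "(+) :: 'g \<Rightarrow> 'g \<Rightarrow> 'g"
    by (rule G_space_left_translation[OF lc])
  have G: "G_space act" by (rule G_space_axioms)
  obtain B where B: "\<And>F. F \<in> LUC act \<Longrightarrow> norm (M F) \<le> B * norm F"
    using M unfolding cdual_def by blast
  have le: "dist (ltrans (+) s (dual_conv act M F)) (ltrans (+) t (dual_conv act M F)) \<le>
      \<bar>B\<bar> * dist (ltrans act s F) (ltrans act t F)" for s t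
  proof (rule dist_bound)
    fix u
    let ?D = "ltrans act s F - ltrans act t F"
    have D: "?D \<in> LUC act" by (intro LUC_diff ltrans_in_LUC F)
    have "dist (ltrans (+) s (dual_conv act M F) u) (ltrans (+) t (dual_conv act M F) u)
        = norm (M (ltrans act (s + u) F) - M (ltrans act (t + u) F))"
      by (simp add: L.apply_ltrans apply_dual_conv[OF M G F] dist_norm)
    also have "\<dots> = norm (M (ltrans act u ?D))"
      by (simp add: ltrans_diff ltrans_ltrans cdual_diff[OF M G] ltrans_in_LUC F)
    also have "\<dots> \<le> B * norm (ltrans act u ?D)"
      by (intro B ltrans_in_LUC D)
    also have "\<dots> \<le> \<bar>B\<bar> * norm ?D"
      by (intro mult_mono norm_ltrans_le) auto
    finally show "dist (ltrans (+) s (dual_conv act M F) u) (ltrans (+) t (dual_conv act M F) u) \<le>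
        \<bar>B\<bar> * dist (ltrans act s F) (ltrans act t F)"
      by (simp add: dist_norm)
  qed
  show ?thesis
    unfolding LUC_def mem_Collect_eq continuous_on
  proof
    fix t
    have "((\<lambda>s. ltrans act s F) \<longlongrightarrow> ltrans act t F) (at t)"
      using F by (simp add: LUC_def continuous_on)
    then have "((\<lambda>s. dist (ltrans act s F) (ltrans act t F)) \<longlongrightarrow> 0) (at t)"
      by (rule iffD1[OF tendsto_dist_iff])
    then have lim: "((\<lambda>s. \<bar>B\<bar> * dist (ltrans act s F) (ltrans act t F)) \<longlongrightarrow> 0) (at t)"
      by (rule tendsto_mult_right_zero)
    show "((\<lambda>s. ltrans (+) s (dual_conv act M F)) \<longlongrightarrow> ltrans (+) t (dual_conv act M F)) (at t within UNIV)"
      by (rule iffD2[OF tendsto_dist_iff], rule Lim_null_comparison[OF _ lim], rule always_eventually) (simp add: le)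
  qed
qed

lemma LUC_add:
  assumes "F \<in> LUC act" "H \<in> LUC act"
  shows "F + H \<in> LUC act"
proof -
  have "ltrans act s (F + H) = ltrans act s F + ltrans act s H" for s
    by (rule bcontfun_eqI) (simp add: apply_ltrans)
  then show ?thesis
    using assms by (auto simp: LUC_def intro!: continuous_intros)
qed

lemma LUC_cscale:
  assumes "F \<in> LUC act"
  shows "cscale c F \<in> LUC act"
proof -
  have le: "dist (ltrans act s (cscale c F)) (ltrans act t (cscale c F)) \<le>
      norm c * dist (ltrans act s F) (ltrans act t F)" for s t
  proof (rule dist_bound)
    fix x
    have "dist (F (act s x)) (F (act t x)) \<le> dist (ltrans act s F) (ltrans act t F)"
      using dist_bounded[of "ltrans act s F" x "ltrans act t F"] by (simp add: apply_ltrans)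
    then show "dist (ltrans act s (cscale c F) x) (ltrans act t (cscale c F) x) \<le>
        norm c * dist (ltrans act s F) (ltrans act t F)"
      by (simp add: apply_ltrans apply_cscale dist_norm norm_mult mult_left_mono
          flip: right_diff_distrib)
  qed
  show ?thesis
    unfolding LUC_def mem_Collect_eq continuous_on
  proof
    fix t
    have "((\<lambda>s. ltrans act s F) \<longlongrightarrow> ltrans act t F) (at t)"
      using assms by (simp add: LUC_def continuous_on)
    then have "((\<lambda>s. dist (ltrans act s F) (ltrans act t F)) \<longlongrightarrow> 0) (at t)"
      by (rule iffD1[OF tendsto_dist_iff])
    then have lim: "((\<lambda>s. norm c * dist (ltrans act s F) (ltrans act t F)) \<longlongrightarrow> 0) (at t)"
      by (rule tendsto_mult_right_zero)
    show "((\<lambda>s. ltrans act s (cscale c F)) \<longlongrightarrow> ltrans act t (cscale c F)) (at t within UNIV)"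
      by (rule iffD2[OF tendsto_dist_iff], rule Lim_null_comparison[OF _ lim], rule always_eventually)
        (simp add: le)
  qed
qed

lemma dual_act_in_cdual:
  assumes lc: "locally_compact_space (euclidean :: 'g topology)"
    and m: "m \<in> cdual (LUC ((+) :: 'g \<Rightarrow> 'g \<Rightarrow> 'g))" and M: "M \<in> cdual (LUC act)"
  shows "dual_act act m M \<in> cdual (LUC act)"
proof -
  have G: "G_space act" by (rule G_space_axioms)
  obtain B where B: "\<And>F. F \<in> LUC act \<Longrightarrow> norm (M F) \<le> B * norm F"
    using M unfolding cdual_def by blast
  obtain C where C: "\<And>F. F \<in> LUC ((+) :: 'g \<Rightarrow> 'g \<Rightarrow> 'g) \<Longrightarrow> norm (m F) \<le> C * norm F"
    using m unfolding cdual_def by blast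
  have in_LUC: "dual_conv act M F \<in> LUC (+)" if "F \<in> LUC act" for F
    using lc M that by (rule dual_conv_in_LUC)
  have add: "dual_conv act M (F + H) = dual_conv act M F + dual_conv act M H"
    if F: "F \<in> LUC act" and H: "H \<in> LUC act" for F H
  proof (rule bcontfun_eqI)
    fix s
    have "ltrans act s (F + H) = ltrans act s F + ltrans act s H"
      by (rule bcontfun_eqI) (simp add: apply_ltrans)
    then show "dual_conv act M (F + H) s = (dual_conv act M F + dual_conv act M H) s"
      using M ltrans_in_LUC[OF F] ltrans_in_LUC[OF H]
      by (simp add: apply_dual_conv[OF M G] LUC_add F H cdual_def)
  qed
  have scale: "dual_conv act M (cscale c F) = cscale c (dual_conv act M F)"
    if F: "F \<in> LUC act" for c F
  proof (rule bcontfun_eqI)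
    fix s
    have "ltrans act s (cscale c F) = cscale c (ltrans act s F)"
      by (rule bcontfun_eqI) (simp add: apply_ltrans apply_cscale)
    then show "dual_conv act M (cscale c F) s = cscale c (dual_conv act M F) s"
      using M ltrans_in_LUC[OF F]
      by (simp add: apply_dual_conv[OF M G] LUC_cscale F apply_cscale cdual_def)
  qed
  have bound: "norm (m (dual_conv act M F)) \<le> (\<bar>C\<bar> * \<bar>B\<bar>) * norm F" if F: "F \<in> LUC act" for F
  proof -
    have "norm (dual_conv act M F s) \<le> \<bar>B\<bar> * norm F" for s
    proof -
      have "norm (M (ltrans act s F)) \<le> B * norm (ltrans act s F)"
        by (intro B ltrans_in_LUC F)
      also have "\<dots> \<le> \<bar>B\<bar> * norm F"
        by (intro mult_mono norm_ltrans_le) auto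
      finally show ?thesis
        by (simp add: apply_dual_conv[OF M G F])
    qed
    then have "norm (dual_conv act M F) \<le> \<bar>B\<bar> * norm F"
      by (rule norm_bound)
    then have "C * norm (dual_conv act M F) \<le> \<bar>C\<bar> * (\<bar>B\<bar> * norm F)"
      by (intro mult_mono) auto
    with C[OF in_LUC[OF F]] show ?thesis
      by (simp add: mult.assoc)
  qed
  have "dual_act act m M (F + H) = dual_act act m M F + dual_act act m M H"
    if "F \<in> LUC act" "H \<in> LUC act" for F H
    using m in_LUC[OF that(1)] in_LUC[OF that(2)]
    by (simp add: dual_act_def that LUC_add add cdual_def)
  moreover have "dual_act act m M (cscale c F) = c * dual_act act m M F"
    if "F \<in> LUC act" for c F
    using m in_LUC[OF that] by (simp add: dual_act_def that LUC_cscale scale cdual_def)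
  moreover have "\<exists>K. \<forall>F\<in>LUC act. norm (dual_act act m M F) \<le> K * norm F"
    using bound by (auto simp: dual_act_def)
  ultimately show ?thesis
    by (simp add: cdual_def dual_act_def)
qed

end

end

theory Submission
  imports Defs
begin

text \<open>
  A weak*-continuous linear functional on \<open>LUC(X,G)\<^sup>*\<close> is evaluation at an element of \<open>LUC(X,G)\<close>.
  For \<open>m\<close> in \<open>ZZ act\<close> and \<open>F\<close> in \<open>LUC act\<close> this gives \<open>H\<close> with \<open>\<langle>m \<cdot> M, F\<rangle> = \<langle>M, H\<rangle>\<close> for all \<open>M\<close>, and
  taking for \<open>M\<close> the point evaluations shows \<open>H = Fm\<close>. Conversely, (b) exhibits \<open>M \<mapsto> \<langle>m \<cdot> M, F\<rangle>\<close> as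
  evaluation at \<open>Fm\<close>, which is weak*-continuous.
\<close>

section \<open>Linear algebra of functionals\<close>

text \<open>The restriction to \<open>V\<close> keeps the combination extensional, as
  \<open>cdual V\<close> requires. This one operation suffices for linearity: taking the zero
  functional for \<open>M\<close> gives scaling.\<close>

definition lincomb :: "'a set \<Rightarrow> ('a \<Rightarrow> complex) \<Rightarrow> complex \<Rightarrow> ('a \<Rightarrow> complex) \<Rightarrow> 'a \<Rightarrow> complex"
  where "lincomb V M c N = (\<lambda>F\<in>V. M F + c * N F)"

lemma lincomb_apply: "F \<in> V \<Longrightarrow> lincomb V M c N F = M F + c * N F"
  by (simp add: lincomb_def)

definition csubspace_bcontfun :: "('x::topological_space \<Rightarrow>\<^sub>C complex) set \<Rightarrow> bool"
  where "csubspace_bcontfun V \<longleftrightarrow>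
    0 \<in> V \<and> (\<forall>F\<in>V. \<forall>H\<in>V. F + H \<in> V) \<and> (\<forall>c. \<forall>F\<in>V. cscale c F \<in> V)"

lemma cdual_zero:
  assumes "csubspace_bcontfun V" "M \<in> cdual V"
  shows "M 0 = 0"
proof -
  have "0 \<in> V" using assms by (simp add: csubspace_bcontfun_def)
  then have "M (0 + 0) = M 0 + M 0"
    using assms unfolding cdual_def by blast
  then show ?thesis by simp
qed

lemma lincomb_in_cdual:
  assumes V: "csubspace_bcontfun V" and M: "M \<in> cdual V" and N: "N \<in> cdual V"
  shows "lincomb V M c N \<in> cdual V"
proof -
  obtain A where A: "\<And>F. F \<in> V \<Longrightarrow> norm (M F) \<le> A * norm F"
    using M unfolding cdual_def by blast
  obtain B where B: "\<And>F. F \<in> V \<Longrightarrow> norm (N F) \<le> B * norm F"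
    using N unfolding cdual_def by blast
  have "norm (M F + c * N F) \<le> (A + norm c * B) * norm F" if "F \<in> V" for F
  proof -
    have "norm (M F + c * N F) \<le> norm (M F) + norm c * norm (N F)"
      by (metis norm_mult norm_triangle_ineq)
    also have "\<dots> \<le> A * norm F + norm c * (B * norm F)"
      by (intro add_mono mult_left_mono A B that) auto
    finally show ?thesis by (simp add: algebra_simps)
  qed
  then have "\<exists>K. \<forall>F\<in>V. norm (lincomb V M c N F) \<le> K * norm F"
    by (auto simp: lincomb_apply)
  then show ?thesis
    using V M N by (auto simp: cdual_def csubspace_bcontfun_def lincomb_def algebra_simps)
qed

lemma zero_in_cdual:
  assumes "csubspace_bcontfun V"
  shows "(\<lambda>F\<in>V. 0) \<in> cdual V"
proof -
  have "\<exists>K. \<forall>F\<in>V. norm ((\<lambda>F\<in>V. 0) F :: complex) \<le> K * norm F"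
    by (rule exI[of _ 0]) simp
  then show ?thesis
    using assms by (simp add: cdual_def csubspace_bcontfun_def)
qed

lemma point_evaluation_in_cdual:
  assumes "csubspace_bcontfun V"
  shows "(\<lambda>F\<in>V. apply_bcontfun F x) \<in> cdual V"
proof -
  have "\<exists>K. \<forall>F\<in>V. norm ((\<lambda>F\<in>V. apply_bcontfun F x) F) \<le> K * norm F"
    by (rule exI[of _ 1]) (simp add: norm_bounded)
  then show ?thesis
    using assms by (simp add: cdual_def csubspace_bcontfun_def apply_cscale)
qed

text \<open>The induction passes to the kernel in \<open>W\<close> of evaluation at one of the elements of \<open>S\<close>.\<close>

lemma functional_eq_evaluation:
  assumes V: "csubspace_bcontfun V" and "finite S" and "S \<subseteq> V" and "W \<subseteq> cdual V"
    and "\<And>M N c. M \<in> W \<Longrightarrow> N \<in> W \<Longrightarrow> lincomb V M c N \<in> W"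
    and "\<And>M N c. M \<in> W \<Longrightarrow> N \<in> W \<Longrightarrow> \<Phi> (lincomb V M c N) = \<Phi> M + c * \<Phi> N"
    and "\<And>M. M \<in> W \<Longrightarrow> \<forall>F\<in>S. M F = 0 \<Longrightarrow> \<Phi> M = 0"
  shows "\<exists>H\<in>V. \<forall>M\<in>W. \<Phi> M = M H"
  using assms(2-)
proof (induction S arbitrary: W rule: finite_induct)
  \<comment> \<open>With no evaluation left to annihilate, the last hypothesis makes
    \<open>\<Phi>\<close> vanish on all of \<open>W\<close>.\<close>
  case empty
  moreover have "0 \<in> V" using V by (simp add: csubspace_bcontfun_def)
  ultimately show ?case
    using cdual_zero[OF V] by (intro bexI[of _ 0] ballI) auto
next
  case (insert G S)
  note closed = insert.prems(3) and linear = insert.prems(4)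
  have G: "G \<in> V" using insert.prems(1) by simp
  define W' where "W' = {M \<in> W. M G = 0}"
  have "\<exists>H\<in>V. \<forall>M\<in>W'. \<Phi> M = M H"
  proof (rule insert.IH)
    show "\<Phi> M = 0" if "M \<in> W'" "\<forall>F\<in>S. M F = 0" for M
      using that insert.prems(5)[of M] by (simp add: W'_def)
  qed (use insert.prems(1,2) closed linear G in \<open>auto simp: W'_def lincomb_apply\<close>)
  then obtain H where H: "H \<in> V" "\<And>M. M \<in> W' \<Longrightarrow> \<Phi> M = M H" by blast
  show ?case
  proof (cases "\<forall>M\<in>W. M G = 0")
    case True
    then show ?thesis using H by (auto simp: W'_def)
  next
    case False
    then obtain N where N: "N \<in> W" "N G \<noteq> 0" by blast
    \<comment> \<open>\<open>N\<close> spans \<open>W\<close> modulo \<open>W'\<close>. Adding a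
      multiple of \<open>G\<close> to \<open>H\<close> changes nothing on \<open>W'\<close>, and
      this \<open>c\<close> makes the evaluation agree with \<open>\<Phi>\<close> at
      \<open>N\<close> as well.\<close>
    define c where "c = (\<Phi> N - N H) / N G"
    have cG: "cscale c G \<in> V" using V G by (simp add: csubspace_bcontfun_def)
    have "\<Phi> M = M (H + cscale c G)" if M: "M \<in> W" for M
    proof -
      \<comment> \<open>Chosen so that M + d N vanishes at \<open>G\<close>, which moves
        \<open>M\<close> along \<open>N\<close> into \<open>W'\<close>.\<close>
      define d where "d = - M G / N G"
      have "lincomb V M d N \<in> W'"
        using closed[OF M N(1)] N(2) G by (simp add: W'_def lincomb_apply d_def)
      from H(2)[OF this] have "\<Phi> M + d * \<Phi> N = M H + d * N H"
        by (simp add: linear[OF M N(1)] lincomb_apply H(1))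
      then have "\<Phi> M = M H - d * (\<Phi> N - N H)" by (simp add: algebra_simps)
      also have "\<dots> = M H + c * M G" by (simp add: c_def d_def)
      also have "\<dots> = M (H + cscale c G)"
      proof -
        have "M \<in> cdual V" using M insert.prems(2) by blast
        then show ?thesis using H(1) G cG by (simp add: cdual_def)
      qed
      finally show ?thesis .
    qed
    moreover have "H + cscale c G \<in> V"
      using V H(1) cG by (simp add: csubspace_bcontfun_def)
    ultimately show ?thesis by blast
  qed
qed

section \<open>The weak* topology\<close>

lemma topspace_weak_star: "topspace (weak_star V) = cdual V"
  by (auto simp: weak_star_def cdual_def PiE_def)

text \<open>Continuity at the zero functional bounds \<open>\<Phi>\<close> on a basic neighbourhood,
  which restricts only finitely many coordinates. A linear map bounded on their common kernel
  vanishes there, so \<open>functional_eq_evaluation\<close> applies.\<close>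

lemma weak_star_continuous_imp_evaluation:
  assumes V: "csubspace_bcontfun V"
    and cont: "continuous_map (weak_star V) euclidean \<Phi>"
    and linear: "\<And>M N c. M \<in> cdual V \<Longrightarrow> N \<in> cdual V \<Longrightarrow> \<Phi> (lincomb V M c N) = \<Phi> M + c * \<Phi> N"
  shows "\<exists>H\<in>V. \<forall>M\<in>cdual V. \<Phi> M = M H"
proof -
  let ?Z = "\<lambda>F\<in>V. 0 :: complex"
  have Z: "?Z \<in> cdual V" by (rule zero_in_cdual[OF V])
  have "lincomb V ?Z 1 ?Z = ?Z" by (auto simp: lincomb_def)
  with linear[OF Z Z, of 1] have \<Phi>Z: "\<Phi> ?Z = 0" by simp
  have "openin (weak_star V) {M \<in> cdual V. \<Phi> M \<in> ball 0 1}"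
    using openin_continuous_map_preimage[OF cont, of "ball 0 1"] by (simp add: topspace_weak_star)
  then obtain T where T: "openin (product_topology (\<lambda>_. euclidean) V) T"
      and T_eq: "{M \<in> cdual V. \<Phi> M \<in> ball 0 1} = T \<inter> cdual V"
    by (auto simp: weak_star_def openin_subtopology)
  have "?Z \<in> {M \<in> cdual V. \<Phi> M \<in> ball 0 1}" using Z \<Phi>Z by simp
  then have "?Z \<in> T" unfolding T_eq by blast
  with T have "\<exists>U. finite {F \<in> V. U F \<noteq> topspace euclidean} \<and> (\<forall>F\<in>V. openin euclidean (U F)) \<and>
      ?Z \<in> PiE V U \<and> PiE V U \<subseteq> T"
    unfolding openin_product_topology_alt by (rule bspec)
  then obtain U where U: "finite {F \<in> V. U F \<noteq> UNIV}" "?Z \<in> PiE V U" "PiE V U \<subseteq> T"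
    unfolding topspace_euclidean by blast
  show ?thesis
  proof (rule functional_eq_evaluation[OF V U(1)])
    fix M assume M: "M \<in> cdual V" and M0: "\<forall>F\<in>{F \<in> V. U F \<noteq> UNIV}. M F = 0"
    \<comment> \<open>All multiples of \<open>M\<close> stay in the neighbourhood: in a restricted
      coordinate they are 0, which \<open>U F\<close> contains because the zero functional lies in
      \<open>PiE V U\<close>.\<close>
    have small: "norm (c * \<Phi> M) < 1" for c
    proof -
      have cM: "lincomb V ?Z c M \<in> cdual V" by (rule lincomb_in_cdual[OF V Z M])
      have "lincomb V ?Z c M F \<in> U F" if "F \<in> V" for F
        using M0 U(2) that by (cases "U F = UNIV") (auto simp: lincomb_apply PiE_iff)
      then have "lincomb V ?Z c M \<in> PiE V U" by (auto simp: lincomb_def)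
      then have "\<Phi> (lincomb V ?Z c M) \<in> ball 0 1" using U(3) T_eq cM by blast
      then show ?thesis by (simp add: linear[OF Z M] \<Phi>Z)
    qed
    show "\<Phi> M = 0"
    proof (rule ccontr)
      assume "\<Phi> M \<noteq> 0"
      with small[of "inverse (\<Phi> M)"] show False by simp
    qed
  qed (auto intro: lincomb_in_cdual[OF V] linear)
qed

text \<open>The weak* topology is initial for the evaluations. That \<open>T\<close> maps into
  \<open>cdual V\<close> supplies the extensionality needed to test continuity
  coordinatewise.\<close>

lemma continuous_map_weak_star_iff:
  assumes "\<And>M. M \<in> cdual V \<Longrightarrow> T M \<in> cdual V"
  shows "continuous_map (weak_star V) (weak_star V) T \<longleftrightarrow>
    (\<forall>F\<in>V. continuous_map (weak_star V) euclidean (\<lambda>M. T M F))"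
proof -
  have "continuous_map (weak_star V) (weak_star V) T \<longleftrightarrow>
      continuous_map (weak_star V) (product_topology (\<lambda>_. euclidean) V) T"
    using assms continuous_map_in_subtopology[of "weak_star V" "product_topology (\<lambda>_. euclidean) V" "cdual V" T]
    by (auto simp: topspace_weak_star weak_star_def[symmetric])
  also have "\<dots> \<longleftrightarrow> (\<forall>F\<in>V. continuous_map (weak_star V) euclidean (\<lambda>M. T M F))"
    using assms by (auto simp: continuous_map_componentwise topspace_weak_star cdual_def)
  finally show ?thesis .
qed

lemma continuous_map_weak_star_evaluation:
  assumes "F \<in> V"
  shows "continuous_map (weak_star V) euclidean (\<lambda>M. M F)"
  unfolding weak_star_def
  by (rule continuous_map_from_subtopology) (rule continuous_map_product_projection[OF assms])

section \<open>The functionals on \<open>LUC act\<close>\<close>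

context G_space
begin

lemma csubspace_LUC: "csubspace_bcontfun (LUC act)"
proof -
  have "ltrans act s 0 = 0" for s
    by (rule bcontfun_eqI) (simp add: apply_ltrans)
  then have "0 \<in> LUC act" by (simp add: LUC_def)
  then show ?thesis by (simp add: csubspace_bcontfun_def LUC_add LUC_cscale)
qed

text \<open>The function MF depends linearly on M, and m is linear. This is the linearity needed to
  represent \<open>\<lambda>M. dual_act act m M F\<close> as an evaluation.\<close>

lemma dual_act_lincomb:
  assumes lc: "locally_compact_space (euclidean :: 'g topology)"
    and m: "m \<in> cdual (LUC ((+) :: 'g \<Rightarrow> 'g \<Rightarrow> 'g))"
    and M: "M \<in> cdual (LUC act)" and N: "N \<in> cdual (LUC act)" and F: "F \<in> LUC act"
  shows "dual_act act m (lincomb (LUC act) M c N) F = dual_act act m M F + c * dual_act act m N F"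
proof -
  interpret L: G_space "(+) :: 'g \<Rightarrow> 'g \<Rightarrow> 'g"
    by (rule G_space_left_translation[OF lc])
  note G = G_space_axioms
  have eq: "dual_conv act (lincomb (LUC act) M c N) F = dual_conv act M F + cscale c (dual_conv act N F)"
    by (rule bcontfun_eqI)
      (simp add: apply_dual_conv[OF _ G F] M N lincomb_in_cdual[OF csubspace_LUC]
        apply_cscale lincomb_apply ltrans_in_LUC F)
  show ?thesis
    using m dual_conv_in_LUC[OF lc M F] dual_conv_in_LUC[OF lc N F]
    by (simp add: dual_act_def F eq cdual_def L.LUC_cscale)
qed

text \<open>Both sides send s to F(s x). Applying m shows that m acting on the point evaluation at x
  has the value (Fm)(x) at F.\<close>

lemma dual_conv_point_evaluation:
  assumes "F \<in> LUC act"
  shows "dual_conv act (\<lambda>F\<in>LUC act. apply_bcontfun F x) F = rtrans act x F"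
  by (rule bcontfun_eqI)
    (simp add: apply_dual_conv[OF point_evaluation_in_cdual[OF csubspace_LUC] G_space_axioms assms]
      ltrans_in_LUC assms apply_ltrans apply_rtrans)

text \<open>A single \<open>H\<close> serves both conditions: its membership in
  \<open>LUC act\<close> gives (a), and the last identity, valid for every \<open>M\<close>, gives
  (b).\<close>

lemma ZZ_imp_fun_conv:
  assumes lc: "locally_compact_space (euclidean :: 'g topology)"
    and m: "m \<in> ZZ act" and F: "F \<in> LUC act"
  obtains H where "H \<in> LUC act" "fun_conv act F m = apply_bcontfun H"
    "\<And>M. M \<in> cdual (LUC act) \<Longrightarrow> dual_act act m M F = M H"
proof -
  have md: "m \<in> cdual (LUC ((+) :: 'g \<Rightarrow> 'g \<Rightarrow> 'g))"
    and cont: "continuous_map (weak_star (LUC act)) (weak_star (LUC act)) (dual_act act m)"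
    using m by (auto simp: ZZ_def)
  have "\<exists>H\<in>LUC act. \<forall>M\<in>cdual (LUC act). dual_act act m M F = M H"
  proof (rule weak_star_continuous_imp_evaluation[OF csubspace_LUC])
    show "continuous_map (weak_star (LUC act)) euclidean (\<lambda>M. dual_act act m M F)"
      using cont F by (simp add: continuous_map_weak_star_iff dual_act_in_cdual[OF lc md])
  qed (rule dual_act_lincomb[OF lc md _ _ F])
  then obtain H where H: "H \<in> LUC act"
      "\<And>M. M \<in> cdual (LUC act) \<Longrightarrow> dual_act act m M F = M H" by blast
  have "fun_conv act F m x = H x" for x
    using H(2)[OF point_evaluation_in_cdual[OF csubspace_LUC]]
    by (simp add: fun_conv_def dual_act_def F H(1) dual_conv_point_evaluation)
  with H that show ?thesis by blast
qed

end

theorem theorem4p3: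
  fixes act :: "'g::{topological_group_add,t2_space} \<Rightarrow> 'x::t2_space \<Rightarrow> 'x"
  assumes "locally_compact_space (euclidean :: 'g topology)"
    and "G_space act"
  shows "ZZ act = {m \<in> cdual (LUC ((+) :: 'g \<Rightarrow> 'g \<Rightarrow> 'g)).
    (\<forall>F\<in>LUC act. fun_conv act F m \<in> apply_bcontfun ` LUC act) \<and>
    (\<forall>M\<in>cdual (LUC act). dual_bullet act M m = dual_act act m M)}"
proof (intro subset_antisym subsetI)
  interpret G_space act by fact
  note lc = assms(1)
  fix m assume m: "m \<in> ZZ act"
  have "fun_conv act F m \<in> apply_bcontfun ` LUC act" if "F \<in> LUC act" for F
    using ZZ_imp_fun_conv[OF lc m that] by blast
  moreover have "dual_bullet act M m = dual_act act m M" if M: "M \<in> cdual (LUC act)" for M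
  proof
    fix F
    \<comment> \<open>Outside \<open>LUC act\<close> both functionals are \<open>undefined\<close>,
      so only \<open>F \<in> LUC act\<close> has content.\<close>
    show "dual_bullet act M m F = dual_act act m M F"
    proof (cases "F \<in> LUC act")
      case True
      from ZZ_imp_fun_conv[OF lc m this] obtain H where "fun_conv act F m = apply_bcontfun H"
        "dual_act act m M F = M H" using M by metis
      then show ?thesis using True by (simp add: dual_bullet_def apply_bcontfun_inverse)
    qed (simp add: dual_bullet_def dual_act_def)
  qed
  ultimately show "m \<in> {m \<in> cdual (LUC ((+) :: 'g \<Rightarrow> 'g \<Rightarrow> 'g)).
      (\<forall>F\<in>LUC act. fun_conv act F m \<in> apply_bcontfun ` LUC act) \<and>
      (\<forall>M\<in>cdual (LUC act). dual_bullet act M m = dual_act act m M)}"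
    using m by (simp add: ZZ_def)
next
  interpret G_space act by fact
  note lc = assms(1)
  fix m assume "m \<in> {m \<in> cdual (LUC ((+) :: 'g \<Rightarrow> 'g \<Rightarrow> 'g)).
    (\<forall>F\<in>LUC act. fun_conv act F m \<in> apply_bcontfun ` LUC act) \<and>
    (\<forall>M\<in>cdual (LUC act). dual_bullet act M m = dual_act act m M)}"
  then have m: "m \<in> cdual (LUC ((+) :: 'g \<Rightarrow> 'g \<Rightarrow> 'g))"
    and a: "\<And>F. F \<in> LUC act \<Longrightarrow> fun_conv act F m \<in> apply_bcontfun ` LUC act"
    and b: "\<And>M. M \<in> cdual (LUC act) \<Longrightarrow> dual_bullet act M m = dual_act act m M"
    by auto
  have "continuous_map (weak_star (LUC act)) euclidean (\<lambda>M. dual_act act m M F)"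
    if F: "F \<in> LUC act" for F
  proof -
    obtain H where H: "H \<in> LUC act" "fun_conv act F m = apply_bcontfun H"
      using a[OF F] by blast
    \<comment> \<open>By (a), \<open>Bcontfun\<close> recovers \<open>H\<close> from the function
      Fm, so (b) reads as evaluation at \<open>H\<close>.\<close>
    have "dual_act act m M F = M H" if "M \<in> cdual (LUC act)" for M
      using b[OF that, symmetric] F by (simp add: dual_bullet_def H(2) apply_bcontfun_inverse)
    then show ?thesis
      by (intro continuous_map_eq[OF continuous_map_weak_star_evaluation[OF H(1)]])
        (simp add: topspace_weak_star)
  qed
  then show "m \<in> ZZ act"
    using m by (simp add: ZZ_def continuous_map_weak_star_iff dual_act_in_cdual[OF lc m])
qed

end
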